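(* Let $G$ be a finite simple $r$-regular graph, where $r\neq 4$, with $es_{\chi'}(G)=2$. Then every minimum mitigating set of $G$ (that is, every mitigating set of size $2$) is a $2$-matching of $G$.
   Context: All graphs are finite, simple and have at least one edge. $\chi'(G)$ is the chromatic index of $G$. A mitigating set of $G$ is a set of edges $F\subseteq E(G)$ such that $\chi'(G\setminus F)<\chi'(G)$, where $G\setminus F$ is $G$ with the edges of $F$ deleted (all vertices are kept; an edgeless graph has chromatic index $0$). The chromatic edge stability index $es_{\chi'}(G)$ is the minimum cardinality of a mitigating set of $G$, and a minimum mitigating set is one of cardinality $es_{\chi'}(G)$. A matching is a set of pairwise non-adjacent edges; a $k$-matching is a matching of size $k$. *)

theory Defs
  imports Main
begin

(* A graph is a pair of a vertex set and a set of edges; an edge is the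
   two-element set of its endpoints. *)
type_synonym 'a ugraph = "'a set \<times> 'a set set"

abbreviation vertices :: "'a ugraph \<Rightarrow> 'a set" where
  "vertices G \<equiv> fst G"

abbreviation edges :: "'a ugraph \<Rightarrow> 'a set set" where
  "edges G \<equiv> snd G"

definition finite_simple_graph :: "'a ugraph \<Rightarrow> bool" where
  "finite_simple_graph G \<longleftrightarrow>
     finite (vertices G) \<and> (\<forall>e \<in> edges G. e \<subseteq> vertices G \<and> card e = 2)"

definition vertex_degree :: "'a ugraph \<Rightarrow> 'a \<Rightarrow> nat" where
  "vertex_degree G v = card {e \<in> edges G. v \<in> e}"

definition regular_graph :: "nat \<Rightarrow> 'a ugraph \<Rightarrow> bool" where
  "regular_graph r G \<longleftrightarrow> (\<forall>v \<in> vertices G. vertex_degree G v = r)"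

definition adjacent_edges :: "'a set \<Rightarrow> 'a set \<Rightarrow> bool" where
  "adjacent_edges e f \<longleftrightarrow> e \<noteq> f \<and> e \<inter> f \<noteq> {}"

definition proper_edge_colouring :: "'a ugraph \<Rightarrow> nat \<Rightarrow> ('a set \<Rightarrow> nat) \<Rightarrow> bool" where
  "proper_edge_colouring G k c \<longleftrightarrow>
     c ` edges G \<subseteq> {..<k} \<and>
     (\<forall>e \<in> edges G. \<forall>f \<in> edges G. adjacent_edges e f \<longrightarrow> c e \<noteq> c f)"

definition chromatic_index :: "'a ugraph \<Rightarrow> nat" where
  "chromatic_index G = (LEAST k. \<exists>c. proper_edge_colouring G k c)"

definition delete_edges :: "'a ugraph \<Rightarrow> 'a set set \<Rightarrow> 'a ugraph" where
  "delete_edges G F = (vertices G, edges G - F)"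

definition mitigating_set :: "'a ugraph \<Rightarrow> 'a set set \<Rightarrow> bool" where
  "mitigating_set G F \<longleftrightarrow>
     F \<subseteq> edges G \<and> chromatic_index (delete_edges G F) < chromatic_index G"

(* Only meaningful when the graph has an edge: an edgeless graph has no
   mitigating set. *)
definition chromatic_edge_stability_index :: "'a ugraph \<Rightarrow> nat" where
  "chromatic_edge_stability_index G = (LEAST k. \<exists>F. mitigating_set G F \<and> card F = k)"

definition minimum_mitigating_set :: "'a ugraph \<Rightarrow> 'a set set \<Rightarrow> bool" where
  "minimum_mitigating_set G F \<longleftrightarrow>
     mitigating_set G F \<and> card F = chromatic_edge_stability_index G"

definition graph_matching :: "'a ugraph \<Rightarrow> 'a set set \<Rightarrow> bool" where
  "graph_matching G M \<longleftrightarrow>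
     M \<subseteq> edges G \<and> (\<forall>e \<in> M. \<forall>f \<in> M. \<not> adjacent_edges e f)"

definition k_matching :: "'a ugraph \<Rightarrow> nat \<Rightarrow> 'a set set \<Rightarrow> bool" where
  "k_matching G k M \<longleftrightarrow> graph_matching G M \<and> card M = k"

lemma finite_edges:
  assumes "finite_simple_graph G"
  shows "finite (edges G)"
  using assms unfolding finite_simple_graph_def
  by (meson Pow_iff finite_Pow_iff finite_subset subsetI)

lemma chromatic_index_attained:
  assumes "finite (edges G)"
  shows "\<exists>c. proper_edge_colouring G (chromatic_index G) c"
proof -
  obtain c :: "'a set \<Rightarrow> nat" and n where "c ` edges G = {i. i < n}" "inj_on c (edges G)"
    using finite_imp_inj_to_nat_seg[OF assms] by blast
  then have "proper_edge_colouring G n c"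
    by (auto simp: proper_edge_colouring_def adjacent_edges_def inj_on_def)
  then have "\<exists>k c. proper_edge_colouring G k c" by blast
  then show ?thesis
    unfolding chromatic_index_def by (rule LeastI_ex)
qed

lemma chromatic_index_edgeless:
  "edges G = {} \<Longrightarrow> chromatic_index G = 0"
  unfolding chromatic_index_def by (rule Least_eq_0) (auto simp: proper_edge_colouring_def[abs_def])

lemma minimum_mitigating_set_exists:
  assumes "finite_simple_graph G" "edges G \<noteq> {}"
  shows "\<exists>F. minimum_mitigating_set G F"
proof -
  have "chromatic_index G \<noteq> 0"
    using chromatic_index_attained[OF finite_edges[OF assms(1)]] assms(2)
    by (auto simp: proper_edge_colouring_def)
  then have "mitigating_set G (edges G)"
    by (simp add: mitigating_set_def delete_edges_def chromatic_index_edgeless)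
  then have "\<exists>k F. mitigating_set G F \<and> card F = k" by blast
  from LeastI_ex[OF this] show ?thesis
    by (simp add: minimum_mitigating_set_def chromatic_edge_stability_index_def)
qed

end

theory Submission
  imports Defs "HOL-Combinatorics.Transposition"
begin

text \<open>
  Let \<open>F\<close> be a minimum mitigating set of size two that is not a matching, say
  \<open>F = {uv, uw}\<close>. By Vizing's theorem, \<open>G\<close> has chromatic index at most \<open>r + 1\<close>, so
  \<open>G \ F\<close> has a proper colouring with \<open>r\<close> colours.

  If \<open>G\<close> itself has chromatic index at most \<open>r\<close>, then \<open>G \ F\<close> needs fewer than \<open>r\<close>
  colours. Hence \<open>F\<close> lowers every degree, which leaves only the vertices \<open>u\<close>, \<open>v\<close>, \<open>w\<close>. But
  every colour of an \<open>r\<close>-colouring of an \<open>r\<close>-regular graph is a perfect matching, and three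
  vertices have none.

  Otherwise the chromatic index is \<open>r + 1\<close>. In an \<open>r\<close>-colouring of \<open>G \ F\<close> a vertex misses as
  many colours as it has edges in \<open>F\<close>: two colours \<open>a, b\<close> are missing at \<open>u\<close>, one colour \<open>g\<close>
  at \<open>v\<close>, one colour \<open>h\<close> at \<open>w\<close>, and none elsewhere. If \<open>g\<close> were missing at \<open>u\<close> too, it
  could be given to \<open>uv\<close>, and \<open>{uw}\<close> would be a smaller mitigating set; the same holds for \<open>h\<close>.
  So \<open>a\<close> is missing at exactly one vertex. A colour class covers an even number of vertices
  (\<open>even_card_vertices_with_colour\<close>), so \<open>G\<close> has odd order and every colour is missing at an
  odd number of vertices. This rules out \<open>g = h\<close>, and it rules out any colour besides \<open>a, b, g, h\<close>.
  Hence \<open>r = 4\<close>.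

  Vizing's theorem is proved one edge at a time (\<open>extend_edge_colouring\<close>): a maximal fan at an
  end of the uncoloured edge can be recoloured, if necessary after a Kempe change.
\<close>

section \<open>Colours missing at a vertex\<close>

definition missing_colours :: "nat \<Rightarrow> 'a set set \<Rightarrow> ('a set \<Rightarrow> nat) \<Rightarrow> 'a \<Rightarrow> nat set" where
  "missing_colours k E c v = {..<k} - c ` {e \<in> E. v \<in> e}"

lemma proper_edge_colouring_mono:
  assumes "proper_edge_colouring (V, E) k c" "E' \<subseteq> E" "k \<le> k'"
  shows "proper_edge_colouring (V', E') k' c"
proof -
  have "c e < k'" if "e \<in> E'" for e
  proof -
    have "c e < k" using assms(1,2) that by (auto simp: proper_edge_colouring_def)
    then show ?thesis using assms(3) by simp
  qed
  moreover have "c e \<noteq> c f" if "e \<in> E'" "f \<in> E'" "adjacent_edges e f" for e f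
    using assms(1) subsetD[OF assms(2) that(1)] subsetD[OF assms(2) that(2)] that(3)
    by (simp add: proper_edge_colouring_def)
  ultimately show ?thesis unfolding proper_edge_colouring_def by auto
qed

lemma proper_edge_colouring_insert:
  assumes "proper_edge_colouring (V, E) k c"
    and "a \<in> missing_colours k E c x" "a \<in> missing_colours k E c y"
  shows "proper_edge_colouring (V, insert {x, y} E) k (c({x, y} := a))"
proof -
  have "a < k" using assms(2) by (simp add: missing_colours_def)
  have "c e \<noteq> a" if "e \<in> E" "adjacent_edges e {x, y} \<or> adjacent_edges {x, y} e" for e
  proof -
    have "x \<in> e \<or> y \<in> e" using that(2) by (auto simp: adjacent_edges_def)
    then show ?thesis using assms(2,3) that(1) by (auto simp: missing_colours_def)
  qed
  moreover have "\<not> adjacent_edges {x, y} {x, y}" by (simp add: adjacent_edges_def)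
  ultimately show ?thesis
    using assms(1) \<open>a < k\<close> unfolding proper_edge_colouring_def by auto
qed

lemma inj_on_edges_at_vertex:
  assumes "proper_edge_colouring (V, E) k c"
  shows "inj_on c {e \<in> E. v \<in> e}"
  using assms unfolding proper_edge_colouring_def adjacent_edges_def inj_on_def by auto

text \<open>
  The colours at a vertex are as many as its edges. This turns statements about degrees into
  statements about missing colours.
\<close>

lemma card_missing_colours:
  assumes "proper_edge_colouring (V, E) k c" "finite E"
  shows "card (missing_colours k E c v) + card {e \<in> E. v \<in> e} = k"
proof -
  have sub: "c ` {e \<in> E. v \<in> e} \<subseteq> {..<k}"
    using assms(1) by (auto simp: proper_edge_colouring_def)
  have "card (c ` {e \<in> E. v \<in> e}) = card {e \<in> E. v \<in> e}"
    using inj_on_edges_at_vertex[OF assms(1)] by (rule card_image)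
  moreover have "card (missing_colours k E c v) = k - card (c ` {e \<in> E. v \<in> e})"
    unfolding missing_colours_def using card_Diff_subset[OF finite_subset[OF sub] sub] by simp
  moreover have "card (c ` {e \<in> E. v \<in> e}) \<le> k"
    using card_mono[OF _ sub] by simp
  ultimately show ?thesis by simp
qed

text \<open>The vertices that see a colour are the ends of the edges of a matching.\<close>

lemma even_card_vertices_with_colour:
  assumes col: "proper_edge_colouring (V, E) k c" and "finite V"
    and edge: "\<And>e. e \<in> E \<Longrightarrow> e \<subseteq> V \<and> card e = 2" and "a < k"
  shows "even (card {v \<in> V. a \<notin> missing_colours k E c v})"
proof -
  let ?M = "{e \<in> E. c e = a}"
  have fin: "finite e" if "e \<in> E" for e
    using edge[OF that] \<open>finite V\<close> by (meson finite_subset)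
  have disj: "pairwise disjnt ?M"
    using col unfolding proper_edge_colouring_def adjacent_edges_def pairwise_def disjnt_def by auto
  have "{v \<in> V. a \<notin> missing_colours k E c v} = \<Union> ?M"
    using edge \<open>a < k\<close> unfolding missing_colours_def by fastforce
  moreover have "card (\<Union> ?M) = (\<Sum>e\<in>?M. card e)"
    using disj fin by (intro card_Union_disjoint) auto
  moreover have "\<dots> = (\<Sum>e\<in>?M. 2)"
    using edge by (intro sum.cong) auto
  ultimately show ?thesis by simp
qed

section \<open>Kempe changes\<close>

text \<open>
  The edges of two colours form paths and cycles, and a vertex that misses one of the two colours
  is the end of a path (possibly of length zero).
\<close>

lemma two_coloured_degree_le:
  assumes "proper_edge_colouring (V, E) k c"
  shows "card {e \<in> {e \<in> E. c e = a \<or> c e = b}. v \<in> e} \<le> 2"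
    and "d \<in> {a, b} \<Longrightarrow> d \<in> missing_colours k E c v \<Longrightarrow>
           card {e \<in> {e \<in> E. c e = a \<or> c e = b}. v \<in> e} \<le> 1"
proof -
  let ?S = "{e \<in> {e \<in> E. c e = a \<or> c e = b}. v \<in> e}"
  have "inj_on c ?S"
    using inj_on_edges_at_vertex[OF assms] by (rule inj_on_subset) auto
  then have eq: "card ?S = card (c ` ?S)"
    by (simp add: card_image)
  have "c ` ?S \<subseteq> {a, b}" by auto
  then have "card (c ` ?S) \<le> card {a, b}" by (intro card_mono) auto
  also have "\<dots> \<le> 2" by (simp add: card_insert_if)
  finally show "card ?S \<le> 2" using eq by simp
  assume d: "d \<in> {a, b}" "d \<in> missing_colours k E c v"
  then have "c ` ?S \<subseteq> {a, b} - {d}" by (auto simp: missing_colours_def)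
  then have "card (c ` ?S) \<le> card ({a, b} - {d})" by (intro card_mono) auto
  also have "\<dots> \<le> 1" using d(1) by (auto simp: card_insert_if insert_Diff_if)
  finally show "card ?S \<le> 1" using eq by simp
qed

text \<open>
  In a graph of maximum degree two, a component is a path or a cycle, so it cannot contain three
  vertices of degree at most one. The component of \<open>x\<close> would serve as \<open>C\<close>. Instead of defining
  components and walking along paths, the induction deletes the edge at \<open>x\<close>, which moves the
  end of the path one step further, and adds \<open>x\<close> to the set found for the smaller graph.
\<close>

lemma closed_region_avoiding_an_endpoint:
  assumes "finite H" "\<And>e. e \<in> H \<Longrightarrow> card e = 2"
    and "\<And>v. card {e \<in> H. v \<in> e} \<le> 2"
    and "card {e \<in> H. x \<in> e} \<le> 1" "card {e \<in> H. y \<in> e} \<le> 1" "card {e \<in> H. z \<in> e} \<le> 1"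
    and "distinct [x, y, z]"
  shows "\<exists>C. x \<in> C \<and> \<not> (y \<in> C \<and> z \<in> C) \<and> (\<forall>e\<in>H. e \<inter> C \<noteq> {} \<longrightarrow> e \<subseteq> C)"
  using assms
proof (induction "card H" arbitrary: H x rule: less_induct)
  case less
  show ?case
  proof (cases "\<exists>e\<in>H. x \<in> e")
    case False
    then show ?thesis using less.prems(7) by (intro exI[of _ "{x}"]) auto
  next
    case True
    then obtain e where e: "e \<in> H" "x \<in> e" by blast
    have fin: "finite {f \<in> K. v \<in> f}" if "K \<subseteq> H" for K v
      using finite_subset[OF that less.prems(1)] by simp
    have only: "f = e" if "f \<in> H" "x \<in> f" for f
      using less.prems(4) e that card_le_Suc0_iff_eq[OF fin[OF subset_refl]] by auto
    obtain x' where x': "e = {x, x'}" "x' \<noteq> x"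
      using less.prems(2)[OF e(1)] e(2) by (auto simp: card_2_iff)
    define K where "K = H - {e}"
    have deg: "card {f \<in> K. v \<in> f} = card {f \<in> H. v \<in> f} - (if v \<in> e then 1 else 0)" for v
    proof -
      have "{f \<in> K. v \<in> f} = {f \<in> H. v \<in> f} - (if v \<in> e then {e} else {})"
        unfolding K_def by auto
      then show ?thesis using e(1) fin[OF subset_refl] by (simp add: card_Diff_subset)
    qed
    show ?thesis
    proof (cases "x' = y \<or> x' = z")
      case True
      \<comment> \<open>The path from \<open>x\<close> is the single edge \<open>e\<close>, because its other end has degree one.\<close>
      have "f = e" if "f \<in> H" "x' \<in> f" for f
        using less.prems(5,6) True e(1) x'(1) that card_le_Suc0_iff_eq[OF fin[OF subset_refl]]
        by auto
      then have "\<forall>f\<in>H. f \<inter> {x, x'} \<noteq> {} \<longrightarrow> f \<subseteq> {x, x'}" using only x'(1) by blast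
      then show ?thesis using True less.prems(7) by (intro exI[of _ "{x, x'}"]) auto
    next
      case False
      have "\<exists>C. x' \<in> C \<and> \<not> (y \<in> C \<and> z \<in> C) \<and> (\<forall>e\<in>K. e \<inter> C \<noteq> {} \<longrightarrow> e \<subseteq> C)"
      proof (rule less.hyps)
        show "card K < card H" unfolding K_def using e(1) less.prems(1)
          by (rule card_Diff1_less[rotated])
        show "finite K" using less.prems(1) by (simp add: K_def)
        show "card f = 2" if "f \<in> K" for f using that less.prems(2) by (simp add: K_def)
        show "card {f \<in> K. v \<in> f} \<le> 2" for v using less.prems(3)[of v] unfolding deg by simp
        show "card {f \<in> K. x' \<in> f} \<le> 1" using less.prems(3)[of x'] x'(1) unfolding deg by simp
        show "card {f \<in> K. y \<in> f} \<le> 1" using less.prems(5) unfolding deg by simp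
        show "card {f \<in> K. z \<in> f} \<le> 1" using less.prems(6) unfolding deg by simp
        show "distinct [x', y, z]" using False less.prems(7) by simp
      qed
      then obtain C where C: "x' \<in> C" "\<not> (y \<in> C \<and> z \<in> C)"
        "\<And>e. e \<in> K \<Longrightarrow> e \<inter> C \<noteq> {} \<Longrightarrow> e \<subseteq> C" by blast
      have "f \<subseteq> insert x C" if "f \<in> H" "f \<inter> insert x C \<noteq> {}" for f
        using that only[OF that(1)] C(1) C(3)[of f] x'(1) by (cases "f = e") (auto simp: K_def)
      then show ?thesis using C(2) less.prems(7) by (intro exI[of _ "insert x C"]) auto
    qed
  qed
qed

text \<open>
  The colours are exchanged outside \<open>C\<close>, so that the colours seen at a vertex of \<open>C\<close> stay as
  they are. When no \<open>a\<close>- or \<open>b\<close>-coloured edge leaves \<open>C\<close>, the complement of \<open>C\<close> is a union of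
  vertex sets of Kempe chains.
\<close>

definition kempe_change ::
    "nat \<Rightarrow> nat \<Rightarrow> 'a set \<Rightarrow> ('a set \<Rightarrow> nat) \<Rightarrow> 'a set \<Rightarrow> nat" where
  "kempe_change a b C c e = (if e \<inter> C = {} then transpose a b (c e) else c e)"

context
  fixes V :: "'a set" and E k c a b C
  assumes col: "proper_edge_colouring (V, E) k c" and ab: "a < k" "b < k"
    and closed: "\<And>e. e \<in> E \<Longrightarrow> c e = a \<or> c e = b \<Longrightarrow> e \<inter> C \<noteq> {} \<Longrightarrow> e \<subseteq> C"
begin

lemma proper_kempe_change: "proper_edge_colouring (V, E) k (kempe_change a b C c)"
proof -
  have "kempe_change a b C c e < k" if "e \<in> E" for e
    using that col ab unfolding kempe_change_def proper_edge_colouring_def transpose_def by auto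
  moreover have "kempe_change a b C c e \<noteq> kempe_change a b C c f"
    if ef: "e \<in> E" "f \<in> E" "adjacent_edges e f" for e f
  proof -
    have ne: "c e \<noteq> c f" using col ef unfolding proper_edge_colouring_def by simp
    \<comment> \<open>Only an exchanged edge \<open>f'\<close> next to an unchanged edge \<open>e'\<close> could cause a conflict. The colour
      of \<open>e'\<close> would then be \<open>a\<close> or \<open>b\<close>, so \<open>e'\<close> would lie inside \<open>C\<close> and could not meet \<open>f'\<close>.\<close>
    have mixed: "c e' \<noteq> transpose a b (c f')"
      if "e' \<in> E" "c e' \<noteq> c f'" "e' \<inter> f' \<noteq> {}" "e' \<inter> C \<noteq> {}" "f' \<inter> C = {}" for e' f'
    proof
      assume eq: "c e' = transpose a b (c f')"
      then have "c e' = a \<or> c e' = b"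
        using that(2) unfolding transpose_def by (auto split: if_splits)
      then have "e' \<subseteq> C" using closed that(1,4) by blast
      then show False using that(3,5) by blast
    qed
    have "e \<inter> f \<noteq> {}" "f \<inter> e \<noteq> {}"
      using ef(3) unfolding adjacent_edges_def by blast+
    then have "e \<inter> C \<noteq> {} \<Longrightarrow> f \<inter> C = {} \<Longrightarrow> c e \<noteq> transpose a b (c f)"
      and "f \<inter> C \<noteq> {} \<Longrightarrow> e \<inter> C = {} \<Longrightarrow> c f \<noteq> transpose a b (c e)"
      using mixed ef(1,2) ne by metis+
    then show ?thesis
      using ne unfolding kempe_change_def by (metis transpose_involutory)
  qed
  ultimately show ?thesis unfolding proper_edge_colouring_def by auto
qed

lemma missing_colours_kempe_change:
  "t \<in> missing_colours k E (kempe_change a b C c) v \<longleftrightarrow>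
     (if v \<in> C then t else transpose a b t) \<in> missing_colours k E c v"
proof (cases "v \<in> C")
  case True
  then have "kempe_change a b C c e = c e" if "v \<in> e" for e
    using that unfolding kempe_change_def by auto
  then show ?thesis using True unfolding missing_colours_def by (auto simp: image_iff)
next
  case False
  have "kempe_change a b C c e = transpose a b (c e)" if e: "e \<in> E" "v \<in> e" for e
  proof (cases "c e = a \<or> c e = b")
    case True
    then have "e \<inter> C = {}" using closed[OF e(1)] e(2) False by blast
    then show ?thesis by (simp add: kempe_change_def)
  next
    case False
    then show ?thesis by (simp add: kempe_change_def)
  qed
  moreover have "transpose a b t < k \<longleftrightarrow> t < k"
    using ab by (auto simp: transpose_def)
  moreover have "t = transpose a b (c e) \<longleftrightarrow> transpose a b t = c e" for e
    by (auto simp: transpose_eq_iff)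
  ultimately show ?thesis using False unfolding missing_colours_def by (auto simp: image_iff)
qed

end

section \<open>Vizing fans\<close>

text \<open>
  The colour of each edge from \<open>x\<close> to the fan, after the first, is free at the preceding vertex,
  so the colours can be passed down the list. The edge to the head of the list is the
  one to be coloured.
\<close>

definition fan :: "nat \<Rightarrow> 'a set set \<Rightarrow> ('a set \<Rightarrow> nat) \<Rightarrow> 'a \<Rightarrow> 'a list \<Rightarrow> bool" where
  "fan k E c x ys \<longleftrightarrow> distinct ys \<and> x \<notin> set ys \<and>
     (\<forall>i. Suc i < length ys \<longrightarrow>
        {x, ys ! Suc i} \<in> E \<and> c {x, ys ! Suc i} \<in> missing_colours k E c (ys ! i))"

text \<open>
  Every edge of the fan takes the colour of its successor, and the last one takes \<open>a\<close>. The
  induction performs one step: it moves the colour of \<open>xz\<close> to \<open>xy\<close>, which leaves \<open>xz\<close>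
  as the uncoloured edge of a shorter fan.
\<close>

lemma colour_fan:
  assumes "proper_edge_colouring (V, E) k c" "fan k E c x (y # ys)" "{x, y} \<notin> E"
    and "a \<in> missing_colours k E c x" "a \<in> missing_colours k E c (last (y # ys))"
  shows "\<exists>c'. proper_edge_colouring (V, insert {x, y} E) k c'"
  using assms
proof (induction ys arbitrary: y E c)
  case Nil
  then show ?case by (auto dest: proper_edge_colouring_insert)
next
  case (Cons z zs)
  let ?b = "c {x, z}"
  define E' where "E' = insert {x, y} (E - {{x, z}})"
  define c' where "c' = c({x, y} := ?b)"
  have fan: "distinct (y # z # zs)" "x \<notin> set (y # z # zs)"
    and step: "\<And>i. i < length (z # zs) \<Longrightarrow>
      {x, (z # zs) ! i} \<in> E \<and> c {x, (z # zs) ! i} \<in> missing_colours k E c ((y # z # zs) ! i)"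
    using Cons.prems(2) unfolding fan_def by auto
  have xz: "{x, z} \<in> E" "?b \<in> missing_colours k E c y" using step[of 0] by auto
  have "proper_edge_colouring (V, E - {{x, z}}) k c"
    by (rule proper_edge_colouring_mono[OF Cons.prems(1)]) auto
  moreover have "?b \<in> missing_colours k (E - {{x, z}}) c x"
    using Cons.prems(1) xz(1)
    unfolding missing_colours_def proper_edge_colouring_def adjacent_edges_def by fastforce
  moreover have "?b \<in> missing_colours k (E - {{x, z}}) c y"
    using xz(2) unfolding missing_colours_def by auto
  ultimately have proper': "proper_edge_colouring (V, E') k c'"
    unfolding E'_def c'_def by (rule proper_edge_colouring_insert)
  have miss: "t \<in> missing_colours k E' c' v"
    if "t \<in> missing_colours k E c v" "v \<noteq> x" "v \<noteq> y" for t v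
    using that unfolding missing_colours_def E'_def c'_def by auto
  have "a \<in> missing_colours k E' c' x"
    using Cons.prems(4) xz(1) unfolding missing_colours_def E'_def c'_def by auto
  moreover have "a \<in> missing_colours k E' c' (last (z # zs))"
  proof -
    have "last (z # zs) \<in> set (z # zs)" by (rule last_in_set) simp
    moreover have "x \<notin> set (z # zs)" "y \<notin> set (z # zs)" using fan by auto
    ultimately have "last (z # zs) \<noteq> x" "last (z # zs) \<noteq> y" by metis+
    moreover have "a \<in> missing_colours k E c (last (z # zs))" using Cons.prems(5) by simp
    ultimately show ?thesis by (intro miss)
  qed
  moreover have "{x, z} \<notin> E'"
    using fan by (auto simp: E'_def doubleton_eq_iff)
  moreover have "fan k E' c' x (z # zs)"
    unfolding fan_def
  proof (intro conjI allI impI)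
    fix i assume i: "Suc i < length (z # zs)"
    let ?p = "(z # zs) ! i" and ?q = "(z # zs) ! Suc i"
    have "?p \<in> set (z # zs)" by (rule nth_mem) (use i in simp)
    moreover have "?q \<in> set zs" using i by simp
    ultimately have mem: "?p \<in> set (z # zs)" "?q \<in> set zs" .
    have ne: "{x, ?q} \<noteq> {x, y}" "{x, ?q} \<noteq> {x, z}" "?p \<noteq> x" "?p \<noteq> y"
      using mem fan by (auto simp: doubleton_eq_iff)
    show "{x, ?q} \<in> E'" using step[OF i] ne by (simp add: E'_def)
    show "c' {x, ?q} \<in> missing_colours k E' c' ?p"
      using step[OF i] ne miss[of _ ?p] by (simp add: c'_def)
  qed (use fan in auto)
  ultimately have "\<exists>d. proper_edge_colouring (V, insert {x, z} E') k d"
    using Cons.IH[OF proper'] by blast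
  moreover have "insert {x, z} E' = insert {x, y} E" using xz(1) by (auto simp: E'_def)
  ultimately show ?case by simp
qed

text \<open>
  Vizing's argument. Take a longest fan \<open>f\<close> at \<open>x\<close> starting with \<open>y\<close>, a colour \<open>a\<close> missing at
  \<open>x\<close> and a colour \<open>b\<close> missing at the last vertex of the fan. If \<open>b\<close> is missing at \<open>x\<close> as well, the fan
  can be coloured. Otherwise, by maximality, the \<open>b\<close>-coloured edge at \<open>x\<close> leads to some fan vertex
  \<open>f ! Suc i\<close>, and \<open>b\<close> is missing both at \<open>f ! i\<close> and at the end of the fan. These two vertices and
  \<open>x\<close> are ends of paths coloured \<open>a\<close> and \<open>b\<close>, so one of the two lies on another path than \<open>x\<close>.
  A Kempe change makes \<open>a\<close> missing there and still at \<open>x\<close>, and the fan up to that vertex can be coloured.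
\<close>

lemma extend_edge_colouring:
  assumes col: "proper_edge_colouring (V, E) k c"
    and "finite E" and edge: "\<And>e. e \<in> E \<Longrightarrow> card e = 2"
    and deg: "\<And>v. card {e \<in> E. v \<in> e} < k"
    and xy: "{x, y} \<notin> E" "x \<noteq> y"
  shows "\<exists>c'. proper_edge_colouring (V, insert {x, y} E) k c'"
proof -
  have missing: "\<exists>a. a \<in> missing_colours k E c v" for v
    using card_missing_colours[OF col \<open>finite E\<close>, of v] deg[of v]
    by (cases "missing_colours k E c v = {}") auto
  let ?P = "\<lambda>ys. fan k E c x (y # ys)"
  have "length ys \<le> card (\<Union> E)" if "?P ys" for ys
  proof -
    have "z \<in> \<Union> E" if z: "z \<in> set ys" for z
    proof -
      obtain i where "i < length ys" "z = ys ! i" using z by (auto simp: in_set_conv_nth)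
      then have "{x, z} \<in> E" using \<open>?P ys\<close> unfolding fan_def by auto
      then show ?thesis by blast
    qed
    then have "set ys \<subseteq> \<Union> E" by blast
    moreover have "finite e" if "e \<in> E" for e
      using edge[OF that] by (simp add: card_ge_0_finite)
    then have "finite (\<Union> E)" using \<open>finite E\<close> by (intro finite_Union)
    ultimately have "card (set ys) \<le> card (\<Union> E)" by (intro card_mono)
    moreover have "card (set ys) = length ys"
      using that unfolding fan_def by (simp add: distinct_card)
    ultimately show ?thesis by simp
  qed
  moreover have "?P []" using xy by (simp add: fan_def)
  ultimately have "\<exists>ys. ?P ys \<and> (\<forall>zs. ?P zs \<longrightarrow> length zs \<le> length ys)"
    by (intro ex_has_greatest_nat[of ?P "[]" length "Suc (card (\<Union> E))"]) 
      (auto simp: less_Suc_eq_le)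
  then obtain ys where ys: "?P ys" and max: "\<And>zs. ?P zs \<Longrightarrow> length zs \<le> length ys"
    by auto
  define f where "f = y # ys"
  define m where "m = length ys"
  have f: "f ! 0 = y" "length f = Suc m" "last f = f ! m" "fan k E c x f"
    using ys by (auto simp: f_def m_def last_conv_nth)
  have step: "{x, f ! Suc i} \<in> E" "c {x, f ! Suc i} \<in> missing_colours k E c (f ! i)"
    if "i < m" for i using f(2,4) that unfolding fan_def by auto
  have dist: "f ! i = f ! j \<longleftrightarrow> i = j" if "i \<le> m" "j \<le> m" for i j
    using f(2,4) that unfolding fan_def by (simp add: nth_eq_iff_index_eq)
  have notx: "f ! i \<noteq> x" if "i \<le> m" for i
    using f(2,4) that unfolding fan_def by (metis le_imp_less_Suc nth_mem)
  obtain a where a: "a \<in> missing_colours k E c x" using missing by blast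
  obtain b where b: "b \<in> missing_colours k E c (f ! m)" using missing by blast
  show ?thesis
  proof (cases "b \<in> missing_colours k E c x")
    case True
    then show ?thesis using colour_fan[OF col ys xy(1)] b f(3) by (auto simp: f_def)
  next
    case False
    then obtain e where e: "e \<in> E" "x \<in> e" "c e = b"
      using b unfolding missing_colours_def by auto
    then obtain z where z: "e = {x, z}" "z \<noteq> x"
      using edge[OF e(1)] by (auto simp: card_2_iff)
    have "z \<in> set f"
    proof (rule ccontr)
      assume new: "z \<notin> set f"
      have "fan k E c x (f @ [z])"
        using f(2,4) new z e b unfolding fan_def by (auto simp: nth_append less_Suc_eq)
      then show False using max[of "ys @ [z]"] by (simp add: f_def)
    qed
    then obtain j where j: "j \<le> m" "z = f ! j"
      using f(2) by (auto simp: in_set_conv_nth less_Suc_eq_le)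
    have "j \<noteq> 0" using j xy(1) e(1) z(1) f(1) by (cases j) auto
    then obtain i where i: "i < m" "z = f ! Suc i"
      using j by (metis Suc_le_lessD not0_implies_Suc)
    have bi: "b \<in> missing_colours k E c (f ! i)" using step(2)[OF i(1)] i z e by simp
    have ab: "a < k" "b < k" "a \<noteq> b" using a b False by (auto simp: missing_colours_def)
    let ?H = "{e \<in> E. c e = a \<or> c e = b}"
    have "\<exists>C. x \<in> C \<and> \<not> (f ! i \<in> C \<and> f ! m \<in> C) \<and> (\<forall>e\<in>?H. e \<inter> C \<noteq> {} \<longrightarrow> e \<subseteq> C)"
    proof (rule closed_region_avoiding_an_endpoint)
      show "card {e \<in> ?H. x \<in> e} \<le> 1"
        using two_coloured_degree_le(2)[OF col _ a] by simp
      show "card {e \<in> ?H. f ! i \<in> e} \<le> 1"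
        using two_coloured_degree_le(2)[OF col _ bi] by simp
      show "card {e \<in> ?H. f ! m \<in> e} \<le> 1"
        using two_coloured_degree_le(2)[OF col _ b] by simp
      show "distinct [x, f ! i, f ! m]"
        using notx[of i] notx[of m] dist[of i m] i(1) by auto
    qed (use two_coloured_degree_le(1)[OF col] \<open>finite E\<close> edge in auto)
    then obtain C where C: "x \<in> C" "\<not> (f ! i \<in> C \<and> f ! m \<in> C)"
      "\<And>e. e \<in> E \<Longrightarrow> c e = a \<or> c e = b \<Longrightarrow> e \<inter> C \<noteq> {} \<Longrightarrow> e \<subseteq> C" by blast
    define c' where "c' = kempe_change a b C c"
    have proper': "proper_edge_colouring (V, E) k c'"
      unfolding c'_def using col ab(1,2) C(3) by (rule proper_kempe_change)
    have miss: "t \<in> missing_colours k E c' v \<longleftrightarrow>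
        (if v \<in> C then t else transpose a b t) \<in> missing_colours k E c v" for t v
      unfolding c'_def using col ab(1,2) C(3) by (rule missing_colours_kempe_change)
    have ax: "a \<in> missing_colours k E c' x" using a C(1) by (simp add: miss)
    have same: "c' {x, v} = c {x, v}" for v using C(1) by (simp add: c'_def kempe_change_def)
    \<comment> \<open>Of the colours that the fan needs, only \<open>b\<close> is affected by the change, and it is needed
      only at \<open>f ! i\<close>. So an initial part of the fan survives if it ends at \<open>f ! i\<close> or earlier,
      or if the colours at \<open>f ! i\<close> were not exchanged.\<close>
    have fan_upto: "fan k E c' x (take (Suc n) f)"
      if n: "n \<le> m" "i < n \<Longrightarrow> f ! i \<in> C" for n
      unfolding fan_def
    proof (intro conjI allI impI)
      fix l assume "Suc l < length (take (Suc n) f)"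
      then have l: "l < n" "l < m" using n(1) f(2) by auto
      let ?d = "c {x, f ! Suc l}"
      have "?d \<noteq> a" using a step(1)[OF l(2)] unfolding missing_colours_def by auto
      moreover have "?d \<noteq> b \<or> f ! l \<in> C"
      proof (cases "l = i")
        case True
        then show ?thesis using n(2) l(1) by simp
      next
        case False
        then have "f ! Suc l \<noteq> f ! Suc i" using dist[of "Suc l" "Suc i"] l(2) i(1) by auto
        then have "{x, f ! Suc l} \<noteq> {x, f ! Suc i}" by (auto simp: doubleton_eq_iff)
        moreover have "{x, f ! Suc l} \<inter> {x, f ! Suc i} \<noteq> {}" by auto
        ultimately show ?thesis
          using col step(1)[OF l(2)] step(1)[OF i(1)] i(2) z(1) e(3)
          unfolding proper_edge_colouring_def adjacent_edges_def by force
      qed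
      ultimately have "?d \<in> missing_colours k E c' (f ! l)"
        using step(2)[OF l(2)] by (auto simp: miss)
      then show "c' {x, take (Suc n) f ! Suc l} \<in> missing_colours k E c' (take (Suc n) f ! l)"
        using l(1) by (simp add: same)
      show "{x, take (Suc n) f ! Suc l} \<in> E" using step(1)[OF l(2)] l(1) by simp
    qed (use f(4) in \<open>auto simp: fan_def dest: in_set_takeD\<close>)
    \<comment> \<open>The earlier candidate \<open>f ! i\<close> is preferred: the end of the fan is used only
      if \<open>f ! i\<close> lies in \<open>C\<close>.\<close>
    obtain n where n: "n \<le> m" "i < n \<Longrightarrow> f ! i \<in> C" "f ! n \<notin> C" "n = i \<or> n = m"
    proof (cases "f ! i \<in> C")
      case True
      then show ?thesis using that[of m] C(2) by auto
    next
      case False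
      then show ?thesis using that[of i] i(1) by auto
    qed
    have "b \<in> missing_colours k E c (f ! n)" using n(4) b bi by auto
    then have an: "a \<in> missing_colours k E c' (f ! n)" using n(3) by (simp add: miss)
    have take: "take (Suc n) f = y # take n ys" by (simp add: f_def)
    have "take (Suc n) f = take n f @ [f ! n]"
      using n(1) f(2) by (intro take_Suc_conv_app_nth) simp
    then have last: "last (y # take n ys) = f ! n" unfolding take by simp
    show ?thesis
      using colour_fan[OF proper', of x y "take n ys" a] fan_upto[OF n(1,2)] xy(1) ax an
      unfolding take last by simp
  qed
qed

theorem vizing:
  assumes "finite E" "\<And>e. e \<in> E \<Longrightarrow> card e = 2" "\<And>v. card {e \<in> E. v \<in> e} < k"
  shows "\<exists>c. proper_edge_colouring (V, E) k c"
  using assms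
proof (induction E rule: finite_induct)
  case empty
  then show ?case by (simp add: proper_edge_colouring_def)
next
  case (insert e E)
  obtain x y where e: "e = {x, y}" "x \<noteq> y"
    using insert.prems(1)[of e] by (auto simp: card_2_iff)
  have deg: "card {f \<in> E. v \<in> f} < k" for v
  proof -
    have "card {f \<in> E. v \<in> f} \<le> card {f \<in> insert e E. v \<in> f}"
      using insert.hyps(1) by (intro card_mono) auto
    then show ?thesis using insert.prems(2)[of v] by simp
  qed
  then obtain c where "proper_edge_colouring (V, E) k c"
    using insert.IH insert.prems(1) by blast
  from extend_edge_colouring[OF this insert.hyps(1) _ deg _ e(2)] show ?case
    using insert.prems(1) insert.hyps(2) e(1) by simp
qed

section \<open>Mitigating sets of two edges in regular graphs\<close>

lemma chromatic_index_le:
  "proper_edge_colouring G k c \<Longrightarrow> chromatic_index G \<le> k"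
  unfolding chromatic_index_def by (rule Least_le) blast

lemma chromatic_edge_stability_index_le:
  "mitigating_set G F \<Longrightarrow> chromatic_edge_stability_index G \<le> card F"
  unfolding chromatic_edge_stability_index_def by (rule Least_le) blast

theorem theorem4p1:
  fixes G :: "'a ugraph" and r :: nat
  assumes "finite_simple_graph G"
    and "edges G \<noteq> {}"
    and "regular_graph r G"
    and "r \<noteq> 4"
    and "chromatic_edge_stability_index G = 2"
  shows "\<forall>F. minimum_mitigating_set G F \<longrightarrow> k_matching G 2 F"
proof (intro allI impI, rule ccontr)
  fix F assume F: "minimum_mitigating_set G F" and no_matching: "\<not> k_matching G 2 F"
  obtain V E where G: "G = (V, E)" by (cases G)
  have edge: "e \<subseteq> V \<and> card e = 2" if "e \<in> E" for e
    using assms(1) that by (simp add: G finite_simple_graph_def)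
  have fin: "finite V" "finite E"
    using assms(1) finite_edges[OF assms(1)] by (simp_all add: G finite_simple_graph_def)
  have regular: "card {e \<in> E. v \<in> e} = r" if "v \<in> V" for v
    using assms(3) that by (simp add: G regular_graph_def vertex_degree_def)
  have FE: "F \<subseteq> E" "card F = 2" and less: "chromatic_index (V, E - F) < chromatic_index G"
    using F assms(5)
    by (simp_all add: G minimum_mitigating_set_def mitigating_set_def delete_edges_def)
  obtain e f where ef: "e \<in> F" "f \<in> F" "e \<noteq> f" "e \<inter> f \<noteq> {}"
    using no_matching FE
    by (auto simp: G k_matching_def graph_matching_def adjacent_edges_def)
  obtain u where u: "u \<in> e" "u \<in> f" using ef(4) by blast
  obtain v where v: "e = {u, v}" "u \<noteq> v"
    using edge[of e] ef(1) FE(1) u(1) by (auto simp: card_2_iff)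
  obtain w where w: "f = {u, w}" "u \<noteq> w"
    using edge[of f] ef(2) FE(1) u(2) by (auto simp: card_2_iff)
  have vw: "v \<noteq> w" using ef(3) v w by auto
  have Feq: "F = {{u, v}, {u, w}}"
    using FE(2) ef v w by (auto simp: card_2_iff)
  have inV: "u \<in> V" "v \<in> V" "w \<in> V" and inE: "{u, v} \<in> E" "{u, w} \<in> E"
    using edge[of e] edge[of f] ef FE(1) v w by auto
  have deg: "card {e \<in> E - F. t \<in> e} + card {e \<in> F. t \<in> e} = r" if "t \<in> V" for t
  proof -
    have "{e \<in> E. t \<in> e} = {e \<in> E - F. t \<in> e} \<union> {e \<in> F. t \<in> e}" using FE(1) by auto
    then have "card {e \<in> E. t \<in> e} = card {e \<in> E - F. t \<in> e} + card {e \<in> F. t \<in> e}"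
      using fin(2) FE(1) by (simp only:) (intro card_Un_disjoint, auto intro: finite_subset)
    then show ?thesis using regular[OF that] by simp
  qed
  have degF: "card {e \<in> F. u \<in> e} = 2" "card {e \<in> F. v \<in> e} = 1" "card {e \<in> F. w \<in> e} = 1"
    "\<And>t. t \<notin> {u, v, w} \<Longrightarrow> card {e \<in> F. t \<in> e} = 0"
  proof -
    have "{e \<in> F. u \<in> e} = F" "{e \<in> F. v \<in> e} = {{u, v}}" "{e \<in> F. w \<in> e} = {{u, w}}"
      using v(2) w(2) vw by (auto simp: Feq)
    then show "card {e \<in> F. u \<in> e} = 2" "card {e \<in> F. v \<in> e} = 1" "card {e \<in> F. w \<in> e} = 1"
      using FE(2) by simp_all
    show "card {e \<in> F. t \<in> e} = 0" if "t \<notin> {u, v, w}" for t using that by (auto simp: Feq)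
  qed
  have "r \<ge> 2" using deg[OF inV(1)] degF(1) by simp
  have "card {e \<in> E. t \<in> e} < Suc r" for t
  proof (cases "t \<in> V")
    case True
    then show ?thesis using regular by simp
  next
    case False
    then have "{e \<in> E. t \<in> e} = {}" using edge by blast
    then show ?thesis by (simp only: card.empty)
  qed
  then obtain c0 where "proper_edge_colouring (V, E) (Suc r) c0"
    using vizing[OF fin(2)] edge by blast
  then have upper: "chromatic_index G \<le> Suc r" unfolding G by (rule chromatic_index_le)
  obtain c where c0: "proper_edge_colouring (V, E - F) (chromatic_index (V, E - F)) c"
    using chromatic_index_attained[of "(V, E - F)"] fin(2) by auto
  then have c: "proper_edge_colouring (V, E - F) r c"
    by (rule proper_edge_colouring_mono) (use less upper in auto)
  show False
  proof (cases "chromatic_index G = Suc r")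
    case False
    obtain d where "proper_edge_colouring G (chromatic_index G) d"
      using chromatic_index_attained[of G] fin(2) by (auto simp: G)
    then have d: "proper_edge_colouring (V, E) r d"
      unfolding G by (rule proper_edge_colouring_mono) (use False upper G in auto)
    have "V \<subseteq> {u, v, w}"
    proof
      fix t assume t: "t \<in> V"
      have "proper_edge_colouring (V, E - F) (r - 1) c"
        using c0 by (rule proper_edge_colouring_mono) (use less upper False in auto)
      from card_missing_colours[OF this, of t]
      have "card {e \<in> E - F. t \<in> e} \<le> r - 1" using fin(2) by simp
      then show "t \<in> {u, v, w}" using deg[OF t] degF(4)[of t] \<open>r \<ge> 2\<close> by fastforce
    qed
    then have "V = {u, v, w}" using inV by auto
    then have "card V = 3" using v(2) w(2) vw by simp
    moreover have "missing_colours r E d t = {}" if "t \<in> V" for t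
      using card_missing_colours[OF d fin(2), of t] regular[OF that]
      by (simp add: missing_colours_def)
    then have "{t \<in> V. 0 \<notin> missing_colours r E d t} = V" by auto
    ultimately show False
      using even_card_vertices_with_colour[OF d fin(1) edge, of 0] \<open>r \<ge> 2\<close> by simp
  next
    case True
    define M where "M = missing_colours r (E - F) c"
    have cardM: "card (M t) = card {e \<in> F. t \<in> e}" if "t \<in> V" for t
      using card_missing_colours[OF c, of t] deg[OF that] fin(2) by (simp add: M_def)
    have finM: "finite (M t)" for t by (simp add: M_def missing_colours_def)
    have subM: "M t \<subseteq> {..<r}" for t by (auto simp: M_def missing_colours_def)
    \<comment> \<open>A colour missing at both ends of one edge of \<open>F\<close> could be given to that edge, and the
      other edge alone would form a mitigating set. The lemma serves both edges, with \<open>s\<close>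
      and \<open>s'\<close> exchanged.\<close>
    have disj: "M u \<inter> M s = {}" if s: "F = {{u, s}, {u, s'}}" for s s'
    proof (rule ccontr)
      assume "M u \<inter> M s \<noteq> {}"
      then obtain a where "a \<in> M u" "a \<in> M s" by blast
      then have "proper_edge_colouring (V, insert {u, s} (E - F)) r (c({u, s} := a))"
        unfolding M_def using c by (intro proper_edge_colouring_insert)
      then have "proper_edge_colouring (V, E - {{u, s'}}) r (c({u, s} := a))"
        by (rule proper_edge_colouring_mono) (use s FE(1) in auto)
      then have "mitigating_set G {{u, s'}}"
        using chromatic_index_le True s FE(1)
        by (fastforce simp: mitigating_set_def delete_edges_def G)
      then show False using chromatic_edge_stability_index_le assms(5) by fastforce
    qed
    obtain a b where ab: "M u = {a, b}" "a \<noteq> b"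
      using cardM[OF inV(1)] degF(1) by (auto simp: card_2_iff)
    obtain g where g: "M v = {g}"
      using cardM[OF inV(2)] degF(2) by (auto simp: card_1_singleton_iff)
    obtain h where h: "M w = {h}"
      using cardM[OF inV(3)] degF(3) by (auto simp: card_1_singleton_iff)
    have other: "M t = {}" if "t \<in> V" "t \<notin> {u, v, w}" for t
      using cardM[OF that(1)] degF(4)[OF that(2)] finM by simp
    have gh: "g \<notin> {a, b}" "h \<notin> {a, b}"
      using disj[of v w] disj[of w v] Feq ab(1) g h by (auto simp: insert_commute)
    have parity: "even (card (V - S))"
      if "S = {t \<in> V. i \<in> M t}" "i < r" for S i
    proof -
      have "V - S = {t \<in> V. i \<notin> missing_colours r (E - F) c t}"
        using that(1) by (auto simp: M_def)
      then show ?thesis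
        using even_card_vertices_with_colour[OF c fin(1) _ that(2)] edge by simp
    qed
    \<comment> \<open>The union is written out because \<open>g = h\<close> is still possible.\<close>
    have missed: "{t \<in> V. i \<in> M t} =
        (if i \<in> {a, b} then {u} else {}) \<union>
        (if i = g then {v} else {}) \<union> (if i = h then {w} else {})" for i
      using other inV ab(1) g h by (auto split: if_splits)
    have less_r: "a < r" "b < r" "g < r" "h < r" using subM ab(1) g h
      by (metis insertI1 insert_subset lessThan_iff)+
    have "even (card (V - {u}))"
      using parity[OF missed[symmetric] less_r(1)] gh by (auto split: if_splits)
    then have odd: "odd (card V)" using inV(1) fin(1)
      by (simp add: card_Diff_singleton)
        (metis card_gt_0_iff dvd_diffD1 empty_iff even_diff_nat odd_one)
    have "g \<noteq> h"
    proof
      assume "g = h"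
      then have "even (card (V - {v, w}))"
        using parity[OF missed[symmetric] less_r(3)] gh by (auto split: if_splits simp: insert_commute)
      moreover have "card (V - {v, w}) + 2 = card V"
        using inV fin(1) vw card_mono[of V "{v, w}"] by (simp add: card_Diff_subset)
      ultimately show False using odd by presburger
    qed
    moreover have "i \<in> {a, b, g, h}" if "i < r" for i
      using parity[OF missed[symmetric] that] odd by (auto split: if_splits)
    then have "{..<r} = {a, b, g, h}" using less_r by auto
    then have "r = card {a, b, g, h}" by (metis card_lessThan)
    ultimately show False using ab(2) gh assms(4) by auto
  qed
qed

end
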